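(* Let $\{f_n\}_{n=1}^\infty$ be a log-concave sequence independent of $\mu$, and let $$f(\mu;x)=\sum_{n=1}^\infty f_n\frac{(\mu)_{2n}}{(2n-1)!}x^n=x(\mu)_2\sum_{n=0}^\infty f_{n+1}\frac{(\mu/2+1)_n(\mu/2+3/2)_n}{(3/2)_n\,n!}x^n .$$ Then the formal power series $f(\mu;x)$ is coefficient-wise log-concave for $\mu\ge0$.
   Context: $(\mu)_n$ is the rising factorial: $(\mu)_0=1$, $(\mu)_n=\mu(\mu+1)\cdots(\mu+n-1)$. A non-negative, not identically zero real sequence $\{f_k\}_{k\ge1}$ is called log-concave if $f_k^2\ge f_{k-1}f_{k+1}$ for all $k\ge2$ and its support $\{k:f_k\neq0\}$ is an interval of integers (no internal zeros). For a formal power series $f(\mu;x)$ in $x$ whose coefficients are non-negative functions of a real parameter $\mu\ge0$, and for $\alpha,\beta\ge0$, the generalized Turánian is the formal power series $$\Delta_f(\alpha,\beta;x)=f(\mu+\alpha;x)f(\mu+\beta;x)-f(\mu;x)f(\mu+\alpha+\beta;x)=\sum_{k\ge0}\delta_kx^k .$$ "$f$ is coefficient-wise log-concave for $\mu\ge0$" means $\delta_k\ge0$ for all $k\ge0$, all $\mu\ge0$ and all $\alpha,\beta\ge0$. *)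

theory Defs
  imports Complex_Main "HOL-Computational_Algebra.Formal_Power_Series"
begin

text \<open>
  A sequence indexed from 1 is a function on \<open>nat\<close> whose value at 0 is
  irrelevant.
\<close>

definition log_concave_seq :: "(nat \<Rightarrow> real) \<Rightarrow> bool" where
  "log_concave_seq f \<longleftrightarrow>
     (\<forall>k\<ge>1. f k \<ge> 0) \<and> (\<exists>k\<ge>1. f k \<noteq> 0) \<and>
     (\<forall>k\<ge>2. (f k)^2 \<ge> f (k - 1) * f (k + 1)) \<and>
     (\<forall>i j k. 1 \<le> i \<and> i \<le> j \<and> j \<le> k \<and> f i \<noteq> 0 \<and> f k \<noteq> 0 \<longrightarrow> f j \<noteq> 0)"

definition gen_turanian :: "(real \<Rightarrow> real fps) \<Rightarrow> real \<Rightarrow> real \<Rightarrow> real \<Rightarrow> real fps" where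
  "gen_turanian F \<mu> \<alpha> \<beta> = F (\<mu> + \<alpha>) * F (\<mu> + \<beta>) - F \<mu> * F (\<mu> + \<alpha> + \<beta>)"

definition coeffwise_log_concave :: "(real \<Rightarrow> real fps) \<Rightarrow> bool" where
  "coeffwise_log_concave F \<longleftrightarrow>
     (\<forall>\<mu>\<ge>0. \<forall>\<alpha>\<ge>0. \<forall>\<beta>\<ge>0. \<forall>k. fps_nth (gen_turanian F \<mu> \<alpha> \<beta>) k \<ge> 0)"

text \<open>
  The sum starts at \<open>n = 1\<close>, hence the explicit zero constant term; the rising
  factorial \<open>(\<mu>)\<^sub>n\<close> is \<open>pochhammer \<mu> n\<close>.
\<close>

definition rising_series :: "(nat \<Rightarrow> real) \<Rightarrow> real \<Rightarrow> real fps" where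
  "rising_series f \<mu> =
     Abs_fps (\<lambda>n. if n = 0 then 0 else f n * (pochhammer \<mu> (2 * n) / fact (2 * n - 1)))"

end

theory Submission imports Defs begin

text \<open>
  Write \<open>2 \<delta>\<^sub>k = (\<Sum>i. f\<^sub>i f\<^bsub>k-i\<^esub> A\<^sub>i)\<close> with \<open>A\<close> symmetric under \<open>i \<mapsto> k - i\<close>. The weights
  \<open>f\<^sub>i f\<^bsub>k-i\<^esub>\<close> increase towards the middle, and on the way to the middle \<open>A\<close> changes sign at most
  once, from minus to plus. Comparing every weight with the one at the sign change reduces the
  claim to constant weights, \<open>(\<Sum>i. A\<^sub>i) \<ge> 0\<close>. For constant weights the series is the even part of
  \<open>\<mu> y (1 - y) powr (-\<mu> - 1)\<close>, \<open>x = y\<^sup>2\<close>, so the product of the series with parameters \<open>a\<close> and \<open>b\<close>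
  has the coefficients \<open>a b (S - T) / 2\<close>, where \<open>S\<close> depends only on \<open>a + b\<close> and \<open>T\<close> is a coefficient
  of \<open>(1 + y) powr (-a - 1) * (1 - y) powr (-b - 1)\<close>. A differential equation gives a recurrence for
  \<open>T\<close> showing that, for fixed \<open>a + b\<close>, it increases with \<open>b - a \<ge> 0\<close>.
\<close>

section \<open>Sums with weights increasing towards the middle\<close>

lemma log_concave_seq_nonneg: "log_concave_seq f \<Longrightarrow> 1 \<le> i \<Longrightarrow> 0 \<le> f i"
  by (simp add: log_concave_seq_def)

text \<open>On the support the ratios \<open>f (j + 1) / f j\<close> do not increase. Absence of
  internal zeros makes all terms between two nonzero ends positive, so the induction may cancel
  \<open>f (i + m)\<close>.\<close>

lemma log_concave_seq_swap:
  assumes f: "log_concave_seq f" and "1 \<le> i"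
  shows "f i * f (i + n + 1) \<le> f (i + 1) * f (i + n)"
proof (cases "f i = 0 \<or> f (i + n + 1) = 0")
  case True
  then show ?thesis
    using log_concave_seq_nonneg[OF f] \<open>1 \<le> i\<close> by auto
next
  case False
  have pos: "0 < f j" if "i \<le> j" "j \<le> i + n + 1" for j
  proof -
    have "f j \<noteq> 0"
      using f False that \<open>1 \<le> i\<close> unfolding log_concave_seq_def by blast
    then show ?thesis
      using log_concave_seq_nonneg[OF f, of j] that \<open>1 \<le> i\<close> by simp
  qed
  have "f i * f (i + m + 1) \<le> f (i + 1) * f (i + m)" if "m \<le> n" for m
    using that
  proof (induction m)
    case 0
    then show ?case by simp
  next
    case (Suc m)
    have lc: "f (i + m) * f (i + m + 2) \<le> (f (i + m + 1))\<^sup>2"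
    proof -
      have "2 \<le> i + m + 1" using \<open>1 \<le> i\<close> by simp
      then have "f (i + m + 1 - 1) * f (i + m + 1 + 1) \<le> (f (i + m + 1))\<^sup>2"
        using f unfolding log_concave_seq_def by blast
      then show ?thesis by simp
    qed
    have p: "0 < f i" "0 < f (i + m)" "0 < f (i + m + 1)"
      using Suc.prems by (auto intro!: pos)
    have "f (i + m) * (f i * f (i + m + 2)) \<le> f i * (f (i + m + 1))\<^sup>2"
      using mult_left_mono[OF lc, of "f i"] p by (simp add: algebra_simps)
    also have "\<dots> = (f i * f (i + m + 1)) * f (i + m + 1)"
      by (simp add: power2_eq_square)
    also have "\<dots> \<le> (f (i + 1) * f (i + m)) * f (i + m + 1)"
      using Suc p by (intro mult_right_mono) auto
    also have "\<dots> = f (i + m) * (f (i + 1) * f (i + m + 1))"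
      by simp
    finally show ?case
      using p by simp
  qed
  from this[of n] show ?thesis by simp
qed

lemma nonneg_sum_weighted:
  fixes A w :: "nat \<Rightarrow> real"
  assumes symA: "\<And>i. 1 \<le> i \<Longrightarrow> i < k \<Longrightarrow> A (k - i) = A i"
    and symw: "\<And>i. 1 \<le> i \<Longrightarrow> i < k \<Longrightarrow> w (k - i) = w i"
    and w: "\<And>i. 1 \<le> i \<Longrightarrow> i < k \<Longrightarrow> 0 \<le> w i"
    and monow: "\<And>i. 1 \<le> i \<Longrightarrow> 2 * (i + 1) \<le> k \<Longrightarrow> w i \<le> w (i + 1)"
    and sign: "\<And>i. 1 \<le> i \<Longrightarrow> 2 * (i + 1) \<le> k \<Longrightarrow> 0 \<le> A i \<Longrightarrow> 0 \<le> A (i + 1)"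
    and sumA: "0 \<le> (\<Sum>i\<in>{1..<k}. A i)"
  shows "0 \<le> (\<Sum>i\<in>{1..<k}. w i * A i)"
proof (cases "\<exists>i. 1 \<le> i \<and> 2 * i \<le> k \<and> 0 \<le> A i")
  case False
  \<comment> \<open>With no nonnegative value in the left half, symmetry makes \<open>A\<close>
    negative throughout, and a nonnegative sum then forces an empty range.\<close>
  have neg: "A i < 0" if "i \<in> {1..<k}" for i
  proof (cases "2 * i \<le> k")
    case True
    then show ?thesis using False that by force
  next
    case hi: False
    then have "\<not> 0 \<le> A (k - i)" using False that by force
    then show ?thesis using symA[of i] that by auto
  qed
  have "{1..<k} = {}"
  proof (rule ccontr)
    assume "{1..<k} \<noteq> {}"
    then have "(\<Sum>i\<in>{1..<k}. A i) < (\<Sum>i\<in>{1..<k}. 0)"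
      by (intro sum_strict_mono) (use neg in auto)
    then show False using sumA by simp
  qed
  then show ?thesis by (simp only: sum.empty)
next
  case True
  \<comment> \<open>The place of the sign change; \<open>w i0\<close> is the constant with which all
    weights are compared.\<close>
  define i0 where "i0 = (LEAST i. 1 \<le> i \<and> 2 * i \<le> k \<and> 0 \<le> A i)"
  have i0: "1 \<le> i0" "2 * i0 \<le> k" "0 \<le> A i0"
    using LeastI_ex[OF True] unfolding i0_def by auto
  have least: "A i < 0" if "1 \<le> i" "i < i0" for i
    using not_less_Least[of i "\<lambda>i. 1 \<le> i \<and> 2 * i \<le> k \<and> 0 \<le> A i"] that i0
    unfolding i0_def by force
  have mono: "w i \<le> w j" if "i \<le> j" "1 \<le> i" "2 * j \<le> k" for i j
    using that
  proof (induction j rule: dec_induct)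
    case (step j)
    then show ?case using monow[of j] by simp
  qed simp
  have after: "0 \<le> A j" if "i0 \<le> j" "2 * j \<le> k" for j
    using that
  proof (induction j rule: dec_induct)
    case (step j)
    then show ?case using sign[of j] i0 by simp
  qed (use i0 in simp)
  have low: "w i0 * A i \<le> w i * A i" if "1 \<le> i" "2 * i \<le> k" for i
  proof (cases "i < i0")
    case True
    then show ?thesis
      using least[of i] mono[of i i0] that i0 by (intro mult_right_mono_neg) auto
  next
    case False
    then show ?thesis
      using after[of i] mono[of i0 i] that i0 by (intro mult_right_mono) auto
  qed
  \<comment> \<open>Indices beyond the middle are reflected to \<open>k - i\<close>.\<close>
  have "w i0 * A i \<le> w i * A i" if "i \<in> {1..<k}" for i
    using low[of i] low[of "k - i"] symA[of i] symw[of i] that by (cases "2 * i \<le> k") auto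
  then have "w i0 * (\<Sum>i\<in>{1..<k}. A i) \<le> (\<Sum>i\<in>{1..<k}. w i * A i)"
    unfolding sum_distrib_left by (rule sum_mono)
  moreover have "0 \<le> w i0 * (\<Sum>i\<in>{1..<k}. A i)"
    using w[of i0] i0 sumA by (cases "i0 < k") auto
  ultimately show ?thesis by linarith
qed

section \<open>The sign change\<close>

text \<open>For \<open>m = 2 * i\<close> and \<open>n = 2 * (k - i)\<close> this is, up to
  factorials, the joint contribution of the indices \<open>i\<close> and \<open>k - i\<close> to a
  coefficient of a product of two series.\<close>

definition sym_pochhammer :: "nat \<Rightarrow> nat \<Rightarrow> real \<Rightarrow> real \<Rightarrow> real" where
  "sym_pochhammer m n a b = pochhammer a m * pochhammer b n + pochhammer a n * pochhammer b m"

text \<open>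
  The sums \<open>A (A + t) u + B (B + t) v\<close> are split into their parts symmetric and antisymmetric in
  \<open>u, v\<close>; each part satisfies the inequality separately.
\<close>

lemma spread_ineq:
  fixes A B C D t u v u' v' :: real
  assumes "0 < C" "C \<le> A" "A \<le> B" "A + B = C + D" "0 \<le> t"
    and uv: "0 < u'" "u' \<le> u" "u \<le> v" "v \<le> v'"
  shows "C * D * (u' + v') * (A * (A + t) * u + B * (B + t) * v)
       \<le> A * B * (u + v) * (C * (C + t) * u' + D * (D + t) * v')"
proof -
  \<comment> \<open>Twice the sum \<open>A * (A + t) * u + B * (B + t) * v\<close> is
    \<open>K * (u + v) + L * (v - u)\<close>; the primed letters do the same for \<open>C\<close>,
    \<open>D\<close>.\<close>
  define K K' L L' where KL: "K = A * (A + t) + B * (B + t)" "K' = C * (C + t) + D * (D + t)"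
    "L = B * (B + t) - A * (A + t)" "L' = D * (D + t) - C * (C + t)"
  have D: "D = A + B - C" using assms by simp
  have CDAB: "C * D \<le> A * B"
  proof -
    have "A * B - C * D = (A - C) * (B - C)" unfolding D by (simp add: algebra_simps)
    moreover have "0 \<le> (A - C) * (B - C)" using assms by (intro mult_nonneg_nonneg) auto
    ultimately show ?thesis by linarith
  qed
  have K: "K \<le> K'"
  proof -
    have "K' - K = 2 * (A * B - C * D)" unfolding KL D by (simp add: algebra_simps)
    moreover have "0 \<le> 2 * (A * B - C * D)" using CDAB by simp
    ultimately have "0 \<le> K' - K" by (simp only:)
    then show ?thesis by simp
  qed
  have L: "L \<le> L'"
  proof -
    have "L' - L = 2 * (A - C) * (A + B + t)" unfolding KL D by (simp add: algebra_simps)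
    moreover have "0 \<le> 2 * (A - C) * (A + B + t)" using assms by (intro mult_nonneg_nonneg) auto
    ultimately show ?thesis by linarith
  qed
  have K0: "0 \<le> K" unfolding KL using assms by (intro add_nonneg_nonneg mult_nonneg_nonneg) auto
  have L0: "0 \<le> L"
  proof -
    have "L = (B - A) * (A + B + t)" unfolding KL by (simp add: algebra_simps)
    then show ?thesis using assms by simp
  qed
  have CD0: "0 \<le> C * D" using assms by simp
  have 1: "C * D * K \<le> A * B * K'"
    by (rule mult_mono[OF CDAB K]) (use CDAB K0 CD0 in auto)
  have 2: "C * D * L \<le> A * B * L'"
    by (rule mult_mono[OF CDAB L]) (use CDAB L0 CD0 in auto)
  \<comment> \<open>The relative spread \<open>(v - u) / (u + v)\<close> is at most that of
    \<open>u'\<close>, \<open>v'\<close>.\<close>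
  have 3: "(u' + v') * (v - u) \<le> (u + v) * (v' - u')"
  proof -
    have "u' * v \<le> u * v'" using uv by (intro mult_mono) auto
    then show ?thesis by (simp add: algebra_simps)
  qed
  have 4: "(u + v) * (u' + v') * (C * D * K) \<le> (u + v) * (u' + v') * (A * B * K')"
    using 1 uv by (intro mult_left_mono) auto
  have 5: "((u' + v') * (v - u)) * (C * D * L) \<le> ((u + v) * (v' - u')) * (A * B * L')"
    by (rule mult_mono[OF 3 2]) (use uv L0 CD0 in auto)
  have "2 * (C * D * (u' + v') * (A * (A + t) * u + B * (B + t) * v))
      = (u + v) * (u' + v') * (C * D * K) + ((u' + v') * (v - u)) * (C * D * L)"
    unfolding KL by (simp add: algebra_simps)
  moreover have "2 * (A * B * (u + v) * (C * (C + t) * u' + D * (D + t) * v'))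
      = (u + v) * (u' + v') * (A * B * K') + ((u + v) * (v' - u')) * (A * B * L')"
    unfolding KL by (simp add: algebra_simps)
  ultimately show ?thesis using 4 5 by linarith
qed

lemma pochhammer_mono_real:
  fixes x y :: real
  assumes "0 \<le> x" "x \<le> y"
  shows "pochhammer x n \<le> pochhammer y n"
  unfolding pochhammer_prod using assms by (intro prod_mono) auto

text \<open>One factor moves from the longer to the shorter rising factorial. By
  \<open>spread_ineq\<close> the value before the move, divided by the value after it, is at most as
  large for \<open>a, b\<close> as for \<open>c, d\<close>, so the inequality persists.\<close>

lemma sym_pochhammer_step:
  fixes a b c d :: real
  assumes "0 < c" "c \<le> a" "a \<le> b" "a + b = c + d" "Suc m \<le> n"
    and le: "sym_pochhammer m (Suc n) c d \<le> sym_pochhammer m (Suc n) a b"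
  shows "sym_pochhammer (Suc m) n c d \<le> sym_pochhammer (Suc m) n a b"
proof -
  define t where "t = n - Suc m"
  have n: "n = Suc m + t" using assms by (simp add: t_def)
  \<comment> \<open>The tail of the rising factorial:
    \<open>pochhammer x n = pochhammer x m * (x + m) * U x\<close>.\<close>
  define U :: "real \<Rightarrow> real" where "U x = pochhammer (x + real (Suc m)) t" for x
  define P where "P x y = pochhammer x m * pochhammer y m" for x y :: real
  have s1: "sym_pochhammer (Suc m) n x y = P x y * ((x + m) * (y + m) * (U x + U y))" for x y
    unfolding sym_pochhammer_def n pochhammer_product' P_def U_def pochhammer_Suc
    by (simp add: algebra_simps)
  have s2: "sym_pochhammer m (Suc n) x y =
      P x y * ((x + m) * ((x + m) + (t + 1)) * U x + (y + m) * ((y + m) + (t + 1)) * U y)" for x y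
  proof -
    have e: "pochhammer z (Suc n) = pochhammer z m * (z + m) * U z * ((z + m) + (t + 1))" for z :: real
      unfolding pochhammer_Suc[of z n] n pochhammer_product' U_def pochhammer_Suc
      by (simp add: algebra_simps)
    show ?thesis
      unfolding sym_pochhammer_def e P_def by (simp add: algebra_simps)
  qed
  have Ppos: "0 < P x y" if "0 < x" "0 < y" for x y
    using that by (simp add: P_def pochhammer_pos)
  have pos: "0 < U c" "U c \<le> U a" "U a \<le> U b" "U b \<le> U d"
    unfolding U_def using assms by (auto intro!: pochhammer_pos pochhammer_mono_real)
  have spread: "(c + m) * (d + m) * (U c + U d) *
       ((a + m) * ((a + m) + (t + 1)) * U a + (b + m) * ((b + m) + (t + 1)) * U b)
     \<le> (a + m) * (b + m) * (U a + U b) *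
       ((c + m) * ((c + m) + (t + 1)) * U c + (d + m) * ((d + m) + (t + 1)) * U d)"
    by (rule spread_ineq) (use assms pos in auto)
  let ?X = "sym_pochhammer m (Suc n) a b" and ?Y = "sym_pochhammer m (Suc n) c d"
  let ?X' = "sym_pochhammer (Suc m) n a b" and ?Y' = "sym_pochhammer (Suc m) n c d"
  have Pab: "0 < P a b" and Pcd: "0 < P c d" using assms by (auto intro!: Ppos)
  have "P a b * P c d * ((c + m) * (d + m) * (U c + U d) *
       ((a + m) * ((a + m) + (t + 1)) * U a + (b + m) * ((b + m) + (t + 1)) * U b))
     \<le> P a b * P c d * ((a + m) * (b + m) * (U a + U b) *
       ((c + m) * ((c + m) + (t + 1)) * U c + (d + m) * ((d + m) + (t + 1)) * U d))"
    using spread Pab Pcd by (intro mult_left_mono) auto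
  then have cross: "?X * ?Y' \<le> ?X' * ?Y"
    unfolding s1 s2 by (simp only: mult_ac)
  have Y0: "0 < ?Y" and Y'0: "0 < ?Y'"
    using assms unfolding sym_pochhammer_def
    by (auto intro!: add_pos_pos mult_pos_pos pochhammer_pos)
  have "?Y * ?Y' \<le> ?X * ?Y'" using le Y'0 by (intro mult_right_mono) auto
  also note cross
  finally have "?Y' * ?Y \<le> ?X' * ?Y" by (simp only: mult.commute)
  then show ?thesis using Y0 by simp
qed

section \<open>Constant weights\<close>

text \<open>\<open>G\<close> is the expansion of \<open>(1 - y) powr (-a)\<close>.\<close>

lemma fps_pochhammer_deriv:
  fixes a :: real
  defines "G \<equiv> Abs_fps (\<lambda>n. pochhammer a n / fact n)"
  shows "fps_deriv G * (1 - fps_X) = fps_const a * G"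
proof (rule fps_ext)
  fix n
  have rec: "real (Suc m) * fps_nth G (Suc m) = (a + real m) * fps_nth G m" for m
    by (simp add: G_def pochhammer_Suc)
  show "fps_nth (fps_deriv G * (1 - fps_X)) n = fps_nth (fps_const a * G) n"
    using rec[of n] by (cases n) (simp_all add: right_diff_distrib algebra_simps)
qed

lemma fps_pochhammer_alternating_deriv:
  fixes a :: real
  defines "G \<equiv> Abs_fps (\<lambda>n. (-1) ^ n * (pochhammer a n / fact n))"
  shows "fps_deriv G * (1 + fps_X) = - (fps_const a * G)"
proof (rule fps_ext)
  fix n
  have rec: "real (Suc m) * fps_nth G (Suc m) = - (a + real m) * fps_nth G m" for m
    by (simp add: G_def pochhammer_Suc) (simp add: field_simps)
  show "fps_nth (fps_deriv G * (1 + fps_X)) n = fps_nth (- (fps_const a * G)) n"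
    using rec[of n] by (cases n) (simp_all add: distrib_left algebra_simps)
qed

text \<open>Coefficient of \<open>y ^ n\<close> in
  \<open>(1 + y) powr (-a) * (1 - y) powr (-b)\<close>.\<close>

definition alt_conv :: "real \<Rightarrow> real \<Rightarrow> nat \<Rightarrow> real" where
  "alt_conv a b n =
     (\<Sum>p\<le>n. (-1) ^ p * (pochhammer a p / fact p) * (pochhammer b (n - p) / fact (n - p)))"

lemma alt_conv_0: "alt_conv a b 0 = 1"
  by (simp add: alt_conv_def)

lemma alt_conv_1: "alt_conv a b (Suc 0) = b - a"
  by (simp add: alt_conv_def)

text \<open>
  Coefficient of \<open>y ^ (n + 1)\<close> in \<open>(1 - y\<^sup>2) T' = ((b - a) + (a + b) y) T\<close> for
  \<open>T = (1 + y) powr (-a) * (1 - y) powr (-b)\<close>.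
\<close>

lemma alt_conv_rec:
  "real (n + 2) * alt_conv a b (n + 2) =
     (b - a) * alt_conv a b (n + 1) + (a + b + real n) * alt_conv a b n"
proof -
  define P where "P = Abs_fps (\<lambda>n. (-1) ^ n * (pochhammer a n / fact n))"
  define Q where "Q = Abs_fps (\<lambda>n. pochhammer b n / fact n)"
  define T where "T = P * Q"
  have T: "fps_nth T k = alt_conv a b k" for k
    by (simp add: T_def P_def Q_def alt_conv_def fps_mult_nth atMost_atLeast0)
  have P: "fps_deriv P * (1 + fps_X) = - (fps_const a * P)"
    unfolding P_def by (rule fps_pochhammer_alternating_deriv)
  have Q: "fps_deriv Q * (1 - fps_X) = fps_const b * Q"
    unfolding Q_def by (rule fps_pochhammer_deriv)
  \<comment> \<open>Each derivative from the product rule takes the factor of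
    \<open>(1 + y) * (1 - y)\<close> that its own equation requires.\<close>
  have "fps_deriv T * (1 - fps_X * fps_X) =
      (fps_deriv P * (1 + fps_X)) * (Q * (1 - fps_X)) +
      (P * (1 + fps_X)) * (fps_deriv Q * (1 - fps_X))"
    unfolding T_def by (simp add: algebra_simps)
  also have "\<dots> = fps_const b * T + (fps_const b * T) * fps_X
      - (fps_const a * T) + (fps_const a * T) * fps_X"
    unfolding P Q T_def by (simp add: algebra_simps)
  finally have ode: "fps_deriv T - fps_deriv T * fps_X * fps_X = fps_const b * T
      + (fps_const b * T) * fps_X - (fps_const a * T) + (fps_const a * T) * fps_X"
    by (simp add: algebra_simps)
  have "real (n + 2) * fps_nth T (n + 2) - real n * fps_nth T n =
      fps_nth (fps_deriv T - fps_deriv T * fps_X * fps_X) (n + 1)"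
    by (cases n) simp_all
  also have "\<dots> = b * fps_nth T (n + 1) + b * fps_nth T n - a * fps_nth T (n + 1) + a * fps_nth T n"
    unfolding ode by simp
  finally have "real (n + 2) * fps_nth T (n + 2) - real n * fps_nth T n =
      b * fps_nth T (n + 1) + b * fps_nth T n - a * fps_nth T (n + 1) + a * fps_nth T n" .
  then show ?thesis
    unfolding T by (simp add: algebra_simps)
qed

text \<open>For a fixed sum of parameters, only the coefficient \<open>b - a\<close> of the
  recurrence changes. Nonnegativity is carried along so that its products can be compared.\<close>

lemma alt_conv_mono:
  fixes a b c d :: real
  assumes s: "a + b = c + d" "0 \<le> a + b" and "a \<le> b" "b - a \<le> d - c"
  shows "0 \<le> alt_conv a b n \<and> alt_conv a b n \<le> alt_conv c d n"
proof (induction n rule: less_induct)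
  case (less n)
  show ?case
  proof (cases "n < 2")
    case True
    then have "n = 0 \<or> n = Suc 0" by auto
    then show ?thesis using assms by (auto simp: alt_conv_0 alt_conv_1)
  next
    case False
    then obtain m where n: "n = m + 2" by (metis add.commute le_Suc_ex not_less)
    note 1 = less.IH[of m] and 2 = less.IH[of "m + 1"]
    have "real n * alt_conv a b n = (b - a) * alt_conv a b (m + 1) + (a + b + m) * alt_conv a b m"
      unfolding n by (rule alt_conv_rec)
    moreover have "real n * alt_conv c d n =
        (d - c) * alt_conv c d (m + 1) + (a + b + m) * alt_conv c d m"
      unfolding n s(1) by (rule alt_conv_rec)
    moreover have "(b - a) * alt_conv a b (m + 1) \<le> (d - c) * alt_conv c d (m + 1)"
      using 2 n assms by (intro mult_mono) auto
    moreover have "(a + b + m) * alt_conv a b m \<le> (a + b + m) * alt_conv c d m"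
      using 1 n assms by (intro mult_left_mono) auto
    moreover have "0 \<le> (b - a) * alt_conv a b (m + 1)" "0 \<le> (a + b + m) * alt_conv a b m"
      using 1 2 n assms by auto
    ultimately have "0 \<le> real n * alt_conv a b n" "real n * alt_conv a b n \<le> real n * alt_conv c d n"
      by linarith+
    then show ?thesis using n by (simp add: zero_le_mult_iff)
  qed
qed

text \<open>Chu-Vandermonde: powers of \<open>1 - y\<close> multiply by adding exponents.\<close>

lemma conv_pochhammer:
  fixes a b :: real
  shows "(\<Sum>p\<le>n. (pochhammer a p / fact p) * (pochhammer b (n - p) / fact (n - p)))
       = pochhammer (a + b) n / fact n"
proof -
  have "pochhammer (a + b) n / fact n =
      (\<Sum>p\<le>n. of_nat (n choose p) * pochhammer a p * pochhammer b (n - p) / fact n)"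
    unfolding pochhammer_binomial_sum sum_divide_distrib ..
  also have "\<dots> = (\<Sum>p\<le>n. (pochhammer a p / fact p) * (pochhammer b (n - p) / fact (n - p)))"
    by (intro sum.cong refl) (simp add: binomial_fact field_simps)
  finally show ?thesis ..
qed

lemma sum_odd_indices:
  fixes G :: "nat \<Rightarrow> real"
  shows "(\<Sum>p\<le>2 * n. (1 - (-1) ^ p) * G p) = 2 * (\<Sum>i<n. G (2 * i + 1))"
  by (induction n) (simp_all add: algebra_simps)

text \<open>Without the case \<open>n = 0\<close>, truncated subtraction would give a constant term
  1.\<close>

definition rising_coeff :: "real \<Rightarrow> nat \<Rightarrow> real" where
  "rising_coeff x n = (if n = 0 then 0 else pochhammer x (2 * n) / fact (2 * n - 1))"

lemma rising_coeff_nonneg: "0 \<le> x \<Longrightarrow> 0 \<le> rising_coeff x n"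
  by (simp add: rising_coeff_def pochhammer_prod prod_nonneg)

lemma rising_coeff_Suc:
  "rising_coeff x (Suc n) = x * (pochhammer (x + 1) (2 * n + 1) / fact (2 * n + 1))"
  by (simp add: rising_coeff_def pochhammer_rec)

text \<open>By \<open>rising_coeff_Suc\<close> the sum runs over the odd \<open>p\<close> in the
  coefficient of \<open>y ^ (2 * n)\<close> of
  \<open>(1 - y) powr (-a - 1) * (1 - y) powr (-b - 1)\<close>. Half the difference of the plain and
  the alternating sum selects these \<open>p\<close>.\<close>

lemma rising_coeff_conv:
  "(\<Sum>i\<in>{1..<Suc n}. rising_coeff a i * rising_coeff b (Suc n - i)) =
     a * b / 2 * (pochhammer (a + b + 2) (2 * n) / fact (2 * n) - alt_conv (a + 1) (b + 1) (2 * n))"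
proof -
  define G where "G p = (pochhammer (a + 1) p / fact p) *
      (pochhammer (b + 1) (2 * n - p) / fact (2 * n - p))" for p
  have "(\<Sum>i\<in>{1..<Suc n}. rising_coeff a i * rising_coeff b (Suc n - i)) =
      (\<Sum>i<n. rising_coeff a (Suc i) * rising_coeff b (n - i))"
    by (rule sum.reindex_bij_witness[of _ Suc "\<lambda>i. i - 1"]) auto
  also have "\<dots> = (\<Sum>i<n. a * b * G (2 * i + 1))"
  proof (rule sum.cong)
    fix i assume "i \<in> {..<n}"
    then obtain j where n: "n = i + Suc j" by (metis add_Suc_right lessThan_iff less_imp_Suc_add)
    have "2 * n - (2 * i + 1) = 2 * j + 1" "n - i = Suc j" unfolding n by auto
    then show "rising_coeff a (Suc i) * rising_coeff b (n - i) = a * b * G (2 * i + 1)"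
      by (simp only: G_def rising_coeff_Suc mult_ac)
  qed simp
  also have "\<dots> = a * b / 2 * (2 * (\<Sum>i<n. G (2 * i + 1)))"
    by (simp add: sum_distrib_left mult.assoc)
  also have "2 * (\<Sum>i<n. G (2 * i + 1)) = (\<Sum>p\<le>2 * n. (1 - (-1) ^ p) * G p)"
    by (rule sum_odd_indices[symmetric])
  also have "\<dots> = (\<Sum>p\<le>2 * n. G p) - alt_conv (a + 1) (b + 1) (2 * n)"
    by (simp add: alt_conv_def G_def left_diff_distrib diff_divide_distrib sum_subtractf mult.assoc)
  also have "(\<Sum>p\<le>2 * n. G p) = pochhammer (a + b + 2) (2 * n) / fact (2 * n)"
    unfolding G_def conv_pochhammer by (simp add: algebra_simps)
  finally show ?thesis .
qed

text \<open>Moving from \<open>c, d\<close> to the closer pair \<open>a, b\<close> raises the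
  product of the parameters and lowers the alternating term, while \<open>S\<close> stays
  fixed.\<close>

lemma rising_coeff_conv_mono:
  fixes a b c d :: real
  assumes "0 < c" "c \<le> a" "a \<le> b" "a + b = c + d"
  shows "(\<Sum>i\<in>{1..<k}. rising_coeff c i * rising_coeff d (k - i))
       \<le> (\<Sum>i\<in>{1..<k}. rising_coeff a i * rising_coeff b (k - i))"
proof (cases k)
  case (Suc n)
  define S where "S = pochhammer (a + b + 2) (2 * n) / fact (2 * n)"
  let ?T = "\<lambda>x y. alt_conv (x + 1) (y + 1) (2 * n)"
  have ab: "(\<Sum>i\<in>{1..<k}. rising_coeff a i * rising_coeff b (k - i)) = a * b / 2 * (S - ?T a b)"
    unfolding Suc S_def by (rule rising_coeff_conv)
  have cd: "(\<Sum>i\<in>{1..<k}. rising_coeff c i * rising_coeff d (k - i)) = c * d / 2 * (S - ?T c d)"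
    unfolding Suc S_def assms(4) by (rule rising_coeff_conv)
  have T: "?T a b \<le> ?T c d"
    using alt_conv_mono[of "a + 1" "b + 1" "c + 1" "d + 1"] assms by auto
  have cdpos: "0 < c * d" using assms by simp
  have cdab: "c * d \<le> a * b"
  proof -
    have d: "d = a + b - c" using assms by simp
    have "a * b - c * d = (a - c) * (b - c)" unfolding d by (simp add: algebra_simps)
    moreover have "0 \<le> (a - c) * (b - c)" using assms by (intro mult_nonneg_nonneg) auto
    ultimately show ?thesis by linarith
  qed
  \<comment> \<open>The sign of \<open>S - ?T c d\<close> is read off from a convolution of
    nonnegative terms.\<close>
  have "0 \<le> c * d / 2 * (S - ?T c d)"
    unfolding cd[symmetric] using assms
    by (intro sum_nonneg mult_nonneg_nonneg rising_coeff_nonneg) auto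
  then have S: "0 \<le> S - ?T c d"
    using cdpos by (simp add: zero_le_mult_iff)
  show ?thesis
    unfolding ab cd using S T cdab cdpos by (intro mult_mono) auto
qed simp

section \<open>Log-concavity\<close>

lemma rising_series_nth: "fps_nth (rising_series f x) n = f n * rising_coeff x n"
  by (simp add: rising_series_def rising_coeff_def)

lemma rising_series_mult_nth:
  "fps_nth (rising_series f x * rising_series f y) k =
     (\<Sum>i\<in>{1..<k}. f i * f (k - i) * (rising_coeff x i * rising_coeff y (k - i)))"
proof -
  have "fps_nth (rising_series f x * rising_series f y) k =
      (\<Sum>i\<in>{0..k}. f i * f (k - i) * (rising_coeff x i * rising_coeff y (k - i)))"
    unfolding fps_mult_nth rising_series_nth by (simp add: mult_ac)
  \<comment> \<open>The end terms contain \<open>rising_coeff\<close> at 0, so the arbitrary value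
    \<open>f 0\<close> drops out.\<close>
  also have "\<dots> = (\<Sum>i\<in>{1..<k}. f i * f (k - i) * (rising_coeff x i * rising_coeff y (k - i)))"
    by (rule sum.mono_neutral_right) (auto simp: rising_coeff_def)
  finally show ?thesis .
qed

lemma sum_reflect_atLeast1:
  fixes g :: "nat \<Rightarrow> real"
  shows "(\<Sum>i\<in>{1..<k}. g (k - i)) = (\<Sum>i\<in>{1..<k}. g i)"
  by (rule sum.reindex_bij_witness[of _ "\<lambda>i. k - i" "\<lambda>i. k - i"]) auto

lemma rising_series_turan:
  fixes a b c d :: real
  assumes f: "log_concave_seq f" and abcd: "0 < c" "c \<le> a" "a \<le> b" "a + b = c + d"
  shows "fps_nth (rising_series f c * rising_series f d) k
       \<le> fps_nth (rising_series f a * rising_series f b) k"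
proof -
  define w where "w i = f i * f (k - i)" for i
  define D where "D i = rising_coeff a i * rising_coeff b (k - i)
      - rising_coeff c i * rising_coeff d (k - i)" for i
  define A where "A i = D i + D (k - i)" for i
  have A: "A i = (sym_pochhammer (2 * i) (2 * (k - i)) a b - sym_pochhammer (2 * i) (2 * (k - i)) c d)
      / (fact (2 * i - 1) * fact (2 * (k - i) - 1))" if "1 \<le> i" "i < k" for i
    using that unfolding A_def D_def rising_coeff_def sym_pochhammer_def
    by (simp add: field_simps)
  have A_iff: "0 \<le> A i \<longleftrightarrow> sym_pochhammer (2 * i) (2 * (k - i)) c d
      \<le> sym_pochhammer (2 * i) (2 * (k - i)) a b" if "1 \<le> i" "i < k" for i
  proof -
    have "0 < fact (2 * i - 1) * (fact (2 * (k - i) - 1) :: real)" by simp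
    then show ?thesis unfolding A[OF that] by (simp only: pos_le_divide_eq) simp
  qed
  have symw: "w (k - i) = w i" if "i < k" for i
    using that by (simp add: w_def mult.commute)
  have sumA: "(\<Sum>i\<in>{1..<k}. A i) = 2 * (\<Sum>i\<in>{1..<k}. D i)"
    unfolding A_def sum.distrib sum_reflect_atLeast1 by simp
  have "0 \<le> (\<Sum>i\<in>{1..<k}. w i * A i)"
  proof (rule nonneg_sum_weighted)
    show "A (k - i) = A i" if "1 \<le> i" "i < k" for i
      using that by (simp add: A_def)
    show "w (k - i) = w i" if "1 \<le> i" "i < k" for i
      using that symw by simp
    show "0 \<le> w i" if "1 \<le> i" "i < k" for i
      using that log_concave_seq_nonneg[OF f] by (simp add: w_def)
    show "w i \<le> w (i + 1)" if "1 \<le> i" "2 * (i + 1) \<le> k" for i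
    proof -
      have "k - i = i + (k - 2 * i - 1) + 1" "k - (i + 1) = i + (k - 2 * i - 1)"
        using that by auto
      then show ?thesis
        unfolding w_def using log_concave_seq_swap[OF f that(1), of "k - 2 * i - 1"] by simp
    qed
    show "0 \<le> A (i + 1)" if "1 \<le> i" "2 * (i + 1) \<le> k" "0 \<le> A i" for i
    proof -
      \<comment> \<open>Passing from \<open>i\<close> to \<open>i + 1\<close> moves two factors,
        hence two uses of \<open>sym_pochhammer_step\<close>; the second needs
        \<open>2 * (i + 1) \<le> n\<close>, which is \<open>2 * (i + 1) \<le> k\<close>.\<close>
      define n where "n = 2 * (k - (i + 1))"
      have n: "2 * (k - i) = Suc (Suc n)" "2 * (i + 1) = Suc (Suc (2 * i))"
        using that by (auto simp: n_def)
      have "sym_pochhammer (2 * i) (Suc (Suc n)) c d \<le> sym_pochhammer (2 * i) (Suc (Suc n)) a b"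
        using A_iff[of i] that unfolding n by auto
      then have "sym_pochhammer (Suc (2 * i)) (Suc n) c d \<le> sym_pochhammer (Suc (2 * i)) (Suc n) a b"
        by (rule sym_pochhammer_step[OF abcd, rotated]) (use that in \<open>auto simp: n_def\<close>)
      then have "sym_pochhammer (Suc (Suc (2 * i))) n c d \<le> sym_pochhammer (Suc (Suc (2 * i))) n a b"
        by (rule sym_pochhammer_step[OF abcd, rotated]) (use that in \<open>auto simp: n_def\<close>)
      then show ?thesis
        using A_iff[of "i + 1"] that unfolding n n_def[symmetric] by auto
    qed
    show "0 \<le> (\<Sum>i\<in>{1..<k}. A i)"
      unfolding sumA using rising_coeff_conv_mono[OF abcd, of k] by (simp add: D_def sum_subtractf)
  qed
  also have "(\<Sum>i\<in>{1..<k}. w i * A i) =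
      (\<Sum>i\<in>{1..<k}. w i * D i) + (\<Sum>i\<in>{1..<k}. w (k - i) * D (k - i))"
    unfolding A_def distrib_left sum.distrib using symw by simp
  also have "\<dots> = 2 * (\<Sum>i\<in>{1..<k}. w i * D i)"
    using sum_reflect_atLeast1[of "\<lambda>i. w i * D i" k] by simp
  finally show ?thesis
    unfolding rising_series_mult_nth w_def D_def by (simp add: right_diff_distrib sum_subtractf)
qed

text \<open>The inner pair is \<open>\<mu> + \<alpha>, \<mu> + \<beta>\<close>, the outer pair
  \<open>\<mu>, \<mu> + \<alpha> + \<beta>\<close>. At \<open>\<mu> = 0\<close> the subtracted
  product vanishes.\<close>

lemma gen_turanian_rising_series_nonneg:
  assumes f: "log_concave_seq f" and "0 \<le> \<mu>" "0 \<le> \<alpha>" "\<alpha> \<le> \<beta>"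
  shows "0 \<le> fps_nth (gen_turanian (rising_series f) \<mu> \<alpha> \<beta>) k"
proof (cases "\<mu> = 0")
  case True
  have "rising_series f 0 = 0"
    by (rule fps_ext) (simp add: rising_series_def pochhammer_0_left)
  moreover have "0 \<le> fps_nth (rising_series f \<alpha> * rising_series f \<beta>) k"
    unfolding rising_series_mult_nth using assms log_concave_seq_nonneg[OF f]
    by (intro sum_nonneg mult_nonneg_nonneg rising_coeff_nonneg) auto
  ultimately show ?thesis
    by (simp add: gen_turanian_def True)
next
  case False
  then show ?thesis
    using rising_series_turan[OF f, of \<mu> "\<mu> + \<alpha>" "\<mu> + \<beta>" "\<mu> + \<alpha> + \<beta>" k] assms
    by (simp add: gen_turanian_def)
qed

section \<open>Hypergeometric form of the coefficients\<close>

lemma rising_coeff_hypergeometric: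
  "rising_coeff x (Suc n) = pochhammer x 2 *
     (pochhammer (x / 2 + 1) n * pochhammer (x / 2 + 3 / 2) n / (pochhammer (3 / 2) n * fact n))"
proof -
  \<comment> \<open>The duplication formula is applied to the factors after the first two and,
    below, to the factorial written as \<open>pochhammer 2 (2 * n)\<close>; the powers of 2
    cancel.\<close>
  have "pochhammer x (2 * Suc n) = pochhammer x 2 * pochhammer (2 * (x / 2 + 1)) (2 * n)"
    using pochhammer_product'[of x 2 "2 * n"] by (simp add: add.commute)
  also have "\<dots> = pochhammer x 2 * (2 ^ (2 * n) * pochhammer (x / 2 + 1) n * pochhammer (x / 2 + 3 / 2) n)"
    unfolding pochhammer_double by (simp add: add.assoc)
  finally have 1: "pochhammer x (2 * Suc n) =
    pochhammer x 2 * (2 ^ (2 * n) * pochhammer (x / 2 + 1) n * pochhammer (x / 2 + 3 / 2) n)" .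
  have "fact (2 * Suc n - 1) = (pochhammer (2 * 1) (2 * n) :: real)"
    by (simp add: pochhammer_fact pochhammer_rec del: fact_Suc)
  also have "\<dots> = 2 ^ (2 * n) * fact n * pochhammer (3 / 2) n"
    unfolding pochhammer_double by (simp add: pochhammer_fact)
  finally have 2: "fact (2 * Suc n - 1) = 2 ^ (2 * n) * fact n * (pochhammer (3 / 2) n :: real)" .
  show ?thesis
    unfolding rising_coeff_def 1 2 by simp
qed

theorem theorem3p6:
  fixes f :: "nat \<Rightarrow> real"
  assumes "log_concave_seq f"
  shows "(\<forall>\<mu>\<ge>0. rising_series f \<mu> =
            fps_X * fps_const (pochhammer \<mu> 2) *
            Abs_fps (\<lambda>n. f (n + 1) *
              (pochhammer (\<mu> / 2 + 1) n * pochhammer (\<mu> / 2 + 3 / 2) n /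
               (pochhammer (3 / 2) n * fact n)))) \<and>
         coeffwise_log_concave (rising_series f)"
proof (intro conjI allI impI)
  fix \<mu> :: real
  show "rising_series f \<mu> =
            fps_X * fps_const (pochhammer \<mu> 2) *
            Abs_fps (\<lambda>n. f (n + 1) *
              (pochhammer (\<mu> / 2 + 1) n * pochhammer (\<mu> / 2 + 3 / 2) n /
               (pochhammer (3 / 2) n * fact n)))" (is "_ = ?R")
  proof (rule fps_ext)
    fix n
    show "fps_nth (rising_series f \<mu>) n = fps_nth ?R n"
    proof (cases n)
      case 0
      then show ?thesis by (simp add: rising_series_nth rising_coeff_def)
    next
      case (Suc m)
      show ?thesis
        unfolding Suc rising_series_nth rising_coeff_hypergeometric
        by (simp add: mult.assoc)
    qed
  qed
next
  show "coeffwise_log_concave (rising_series f)"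
    unfolding coeffwise_log_concave_def
  proof (intro allI impI)
    fix \<mu> \<alpha> \<beta> :: real and k
    assume nonneg: "0 \<le> \<mu>" "0 \<le> \<alpha>" "0 \<le> \<beta>"
    \<comment> \<open>Symmetry in \<open>\<alpha>\<close> and \<open>\<beta>\<close> reduces the
      claim to ordered shifts.\<close>
    have "gen_turanian (rising_series f) \<mu> \<alpha> \<beta> = gen_turanian (rising_series f) \<mu> \<beta> \<alpha>"
      by (simp add: gen_turanian_def add_ac mult.commute)
    then show "0 \<le> fps_nth (gen_turanian (rising_series f) \<mu> \<alpha> \<beta>) k"
      using gen_turanian_rising_series_nonneg[OF assms, of \<mu> \<alpha> \<beta> k]
        gen_turanian_rising_series_nonneg[OF assms, of \<mu> \<beta> \<alpha> k] nonneg
      by (cases "\<alpha> \<le> \<beta>") auto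
  qed
qed

end
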